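(* Let $X$ be a compact uniform space and $E$ an entourage in $X$ such that $X_E$ is chain connected. Then the group $\delta_E(X)$ is finitely generated.
   Context: All entourages are taken to be symmetric. Fix a basepoint $*\in X$. For an entourage $E$ of $X$, an $E$-chain from $p$ to $q$ is a finite sequence $\{x_0=p,\dots,x_n=q\}$ with $(x_i,x_{i+1})\in E$ for all $i$; it is an $E$-loop if $p=q$. Two $E$-chains with the same endpoints are $E$-homotopic if one is obtained from the other in finitely many steps, each adding or removing a single point, always keeping the endpoints fixed and keeping an $E$-chain at each stage (in particular $\{p\}$ and $\{p,p\}$ are $E$-homotopic); $[\alpha]_E$ is the class of $\alpha$. $X_E$ is the set of $E$-homotopy classes of $E$-chains starting at $*$. For an entourage $D\subset E$ let $D^*$ be the set of pairs $([*=x_0,\dots,x_n,y]_E,[*=x_0,\dots,x_n,z]_E)$ with $(y,z)\in D$; $X_E$ carries the uniformity with base $\{D^*:D\subset E\}$. $\delta_E(X)$ is the group of $E$-homotopy classes of $E$-loops at $*$, with operation induced by concatenation. A uniform space is chain connected if every uniformly continuous function from it to a discrete uniform space is constant (equivalently, for every entourage $F$ every pair of points is joined by an $F$-chain). *)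

theory Defs
  imports "HOL-Analysis.Analysis" "HOL-Algebra.Generated_Groups"
begin

definition entourage :: "('a::uniform_space \<times> 'a) set \<Rightarrow> bool" where
  "entourage E \<longleftrightarrow> sym E \<and> eventually (\<lambda>p. p \<in> E) uniformity"

definition E_chain :: "('a \<times> 'a) set \<Rightarrow> 'a \<Rightarrow> 'a \<Rightarrow> 'a list \<Rightarrow> bool" where
  "E_chain E p q xs \<longleftrightarrow>
     xs \<noteq> [] \<and> hd xs = p \<and> last xs = q \<and> successively (\<lambda>x y. (x, y) \<in> E) xs"

text \<open>
  A step adds the single point \<open>z\<close>. The position of \<open>z\<close> is unrestricted; requiring both lists to
  be chains between the same two points keeps the endpoints fixed while still allowing an endpoint
  to be repeated, as in \<open>[p]\<close> and \<open>[p, p]\<close>.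
\<close>

definition E_step :: "('a \<times> 'a) set \<Rightarrow> 'a list \<Rightarrow> 'a list \<Rightarrow> bool" where
  "E_step E xs ys \<longleftrightarrow>
     (\<exists>p q. E_chain E p q xs \<and> E_chain E p q ys) \<and>
     (\<exists>us z vs. xs = us @ vs \<and> ys = us @ z # vs)"

definition E_homotopic :: "('a \<times> 'a) set \<Rightarrow> 'a list \<Rightarrow> 'a list \<Rightarrow> bool" where
  "E_homotopic E = (symclp (E_step E))\<^sup>*\<^sup>*"

definition E_class :: "('a \<times> 'a) set \<Rightarrow> 'a list \<Rightarrow> 'a list set" where
  "E_class E xs = {ys. E_homotopic E xs ys}"

text \<open>The set \<open>X\<^sub>E\<close> with basepoint \<open>b\<close>.\<close>

definition chain_space :: "('a \<times> 'a) set \<Rightarrow> 'a \<Rightarrow> 'a list set set" where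
  "chain_space E b = {E_class E xs |xs q. E_chain E b q xs}"

text \<open>The set \<open>D\<^sup>*\<close>; here \<open>xs\<close> is the common initial part from \<open>b\<close> to \<open>x\<^sub>n\<close>.\<close>

definition star_entourage ::
    "('a \<times> 'a) set \<Rightarrow> 'a \<Rightarrow> ('a \<times> 'a) set \<Rightarrow> ('a list set \<times> 'a list set) set" where
  "star_entourage E b D =
     {(E_class E (xs @ [y]), E_class E (xs @ [z])) |xs y z.
        xs \<noteq> [] \<and> E_chain E b y (xs @ [y]) \<and> E_chain E b z (xs @ [z]) \<and> (y, z) \<in> D}"

definition chain_space_uniformity ::
    "('a::uniform_space \<times> 'a) set \<Rightarrow> 'a \<Rightarrow> ('a list set \<times> 'a list set) filter" where
  "chain_space_uniformity E b =
     (INF D\<in>{D. entourage D \<and> D \<subseteq> E}. principal (star_entourage E b D))"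

text \<open>
  For a uniform space given by a carrier \<open>S\<close> and a filter \<open>U\<close> on pairs from \<open>S\<close>. The discrete
  uniformity is \<open>principal Id\<close>. One cannot quantify over all target types inside a definition; the
  source type is large enough, as \<open>chain_connected_on_constant\<close> below shows.
\<close>

definition chain_connected_on :: "'a set \<Rightarrow> ('a \<times> 'a) filter \<Rightarrow> bool" where
  "chain_connected_on S U \<longleftrightarrow>
     (\<forall>f :: 'a \<Rightarrow> 'a. (LIM (x, y) U. (f x, f y) :> principal Id) \<longrightarrow> f constant_on S)"

text \<open>The group \<open>\<delta>\<^sub>E(X)\<close>; dropping the head of the second loop merges the two copies of \<open>b\<close>.\<close>

definition loop_group :: "('a \<times> 'a) set \<Rightarrow> 'a \<Rightarrow> 'a list set monoid" where
  "loop_group E b =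
     \<lparr>carrier = {E_class E xs |xs. E_chain E b b xs},
      mult = (\<lambda>A B. \<Union>xs\<in>A. \<Union>ys\<in>B. E_class E (xs @ tl ys)),
      one = E_class E [b]\<rparr>"

definition finitely_generated_group :: "('g, 'm) monoid_scheme \<Rightarrow> bool" where
  "finitely_generated_group G \<longleftrightarrow>
     group G \<and> (\<exists>S. finite S \<and> S \<subseteq> carrier G \<and> generate G S = carrier G)"


subsection \<open>Chain connectedness\<close>

lemma LIM_principal_Id:
  "(LIM (x, y) U. (f x, f y) :> principal Id) \<longleftrightarrow> eventually (\<lambda>(x, y). f x = f y) U"
  by (simp add: filterlim_principal case_prod_unfold)

lemma chain_connected_on_constant:
  fixes f :: "'a \<Rightarrow> 'b"
  assumes "chain_connected_on S U" and f: "LIM (x, y) U. (f x, f y) :> principal Id"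
  shows "f constant_on S"
proof (rule ccontr)
  assume n: "\<not> f constant_on S"
  then obtain p where p: "p \<in> S"
    by (auto simp: constant_on_def)
  from n obtain q where q: "q \<in> S" "f q \<noteq> f p"
    unfolding constant_on_def by metis
  define g where "g x = (if f x = f p then p else q)" for x
  have "eventually (\<lambda>(x, y). g x = g y) U"
    using f unfolding LIM_principal_Id
    by (rule eventually_mono) (auto simp: g_def)
  then have "g constant_on S"
    using assms(1) unfolding chain_connected_on_def LIM_principal_Id by blast
  then show False
    using p q unfolding constant_on_def g_def by metis
qed

lemma chain_connected_on_iff:
  assumes U: "eventually (\<lambda>(x, y). x \<in> S \<and> y \<in> S) U"
  shows "chain_connected_on S U \<longleftrightarrow>
    (\<forall>F. sym F \<and> eventually (\<lambda>p. p \<in> F) U \<longrightarrow>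
      (\<forall>p\<in>S. \<forall>q\<in>S. \<exists>xs. set xs \<subseteq> S \<and> E_chain F p q xs))" (is "?L \<longleftrightarrow> ?R")
proof
  assume L: ?L
  show ?R
  proof (intro allI impI ballI)
    fix F p q
    assume F: "sym F \<and> eventually (\<lambda>p. p \<in> F) U" and pq: "p \<in> S" "q \<in> S"
    define R where "R x \<longleftrightarrow> (\<exists>xs. set xs \<subseteq> S \<and> E_chain F p x xs)" for x
    have ext: "R y" if "R x" "(x, y) \<in> F" "y \<in> S" for x y
    proof -
      obtain xs where "set xs \<subseteq> S" "E_chain F p x xs"
        using \<open>R x\<close> by (auto simp: R_def)
      then have "set (xs @ [y]) \<subseteq> S \<and> E_chain F p y (xs @ [y])"
        using that by (auto simp: E_chain_def successively_append_iff)
      then show ?thesis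
        unfolding R_def by blast
    qed
    have "eventually (\<lambda>(x, y). R x = R y) U"
      using eventually_conj[OF U conjunct2[OF F]]
    proof (rule eventually_mono, clarsimp)
      fix x y assume "x \<in> S" "y \<in> S" "(x, y) \<in> F"
      moreover from this F have "(y, x) \<in> F"
        by (auto dest: symD)
      ultimately show "R x = R y"
        using ext by blast
    qed
    then have "R constant_on S"
      using chain_connected_on_constant[OF L, of R] unfolding LIM_principal_Id by blast
    moreover have "R p"
      unfolding R_def by (rule exI[of _ "[p]"]) (use pq in \<open>auto simp: E_chain_def\<close>)
    ultimately have "R q"
      using pq unfolding constant_on_def by metis
    then show "\<exists>xs. set xs \<subseteq> S \<and> E_chain F p q xs"
      by (simp add: R_def)
  qed
next
  assume R: ?R
  show ?L
    unfolding chain_connected_on_def LIM_principal_Id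
  proof (intro allI impI)
    fix f :: "'a \<Rightarrow> 'a" assume f: "eventually (\<lambda>(x, y). f x = f y) U"
    have eq: "f p = f q" if "E_chain {(x, y). f x = f y} p q xs" for p q xs
      using that
      by (induction xs arbitrary: p) (auto simp: E_chain_def successively_Cons split: if_splits)
    have "sym {(x, y). f x = f y} \<and> eventually (\<lambda>p. p \<in> {(x, y). f x = f y}) U"
      using f by (auto simp: sym_def case_prod_unfold)
    then have "f p = f q" if "p \<in> S" "q \<in> S" for p q
      using R eq that by metis
    then show "f constant_on S"
      unfolding constant_on_def by metis
  qed
qed


subsection \<open>Homotopy of chains\<close>

lemma E_homotopic_refl [simp]: "E_homotopic E xs xs"
  by (simp add: E_homotopic_def)

lemma E_homotopic_sym: "E_homotopic E xs ys \<Longrightarrow> E_homotopic E ys xs"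
  unfolding E_homotopic_def by (metis symp_rtranclp_symclp sympD)

lemma E_homotopic_trans [trans]:
  "E_homotopic E xs ys \<Longrightarrow> E_homotopic E ys zs \<Longrightarrow> E_homotopic E xs zs"
  unfolding E_homotopic_def by (rule rtranclp_trans)

lemma E_class_eq_iff: "E_class E xs = E_class E ys \<longleftrightarrow> E_homotopic E xs ys"
  unfolding E_class_def using E_homotopic_refl E_homotopic_sym E_homotopic_trans by blast

lemma E_homotopic_step: "E_step E xs ys \<Longrightarrow> E_homotopic E xs ys"
  unfolding E_homotopic_def by auto

lemma E_homotopic_chain:
  assumes "E_homotopic E xs ys" "E_chain E p q xs" shows "E_chain E p q ys"
  using assms(1) unfolding E_homotopic_def
proof (induction rule: rtranclp_induct)
  case (step y z)
  then show ?case
    by (auto simp: E_step_def E_chain_def symclp_def)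
qed (use assms(2) in simp)

lemma E_chain_append:
  assumes "E_chain E p q xs" "E_chain E q r ys"
  shows "E_chain E p r (xs @ tl ys)"
  using assms
  by (cases ys) (auto simp: E_chain_def successively_append_iff successively_Cons)

lemma E_step_append_right:
  assumes "E_step E xs xs'" "E_chain E p q xs" "E_chain E q r ys"
  shows "E_step E (xs @ tl ys) (xs' @ tl ys)"
proof -
  have "E_chain E p q xs'"
    using E_homotopic_chain[OF E_homotopic_step[OF assms(1)] assms(2)] .
  then show ?thesis
    using assms E_chain_append[of E p q _ r ys] unfolding E_step_def
    by (metis append_assoc append_Cons)
qed

lemma E_step_append_left:
  assumes "E_step E ys ys'" "E_chain E p q xs" "E_chain E q r ys"
  shows "E_step E (xs @ tl ys) (xs @ tl ys')"
proof -
  have c: "E_chain E q r ys'"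
    using E_homotopic_chain[OF E_homotopic_step[OF assms(1)] assms(3)] .
  obtain us z vs where yz: "ys = us @ vs" "ys' = us @ z # vs"
    using assms(1) unfolding E_step_def by blast
  have "\<exists>us' z' vs'. xs @ tl ys = us' @ vs' \<and> xs @ tl ys' = us' @ z' # vs'"
  proof (cases us)
    case Nil
    obtain v ws where "vs = v # ws"
      using assms(3) yz Nil by (cases vs) (auto simp: E_chain_def)
    then have "xs @ tl ys = xs @ ws \<and> xs @ tl ys' = xs @ v # ws"
      using yz Nil by simp
    then show ?thesis by blast
  next
    case (Cons u ts)
    then have "xs @ tl ys = (xs @ ts) @ vs \<and> xs @ tl ys' = (xs @ ts) @ z # vs"
      using yz by simp
    then show ?thesis by blast
  qed
  then show ?thesis
    unfolding E_step_def using E_chain_append[OF assms(2,3)] E_chain_append[OF assms(2) c] by blast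
qed

lemma E_homotopic_append_right:
  assumes "E_homotopic E xs xs'" "E_chain E p q xs" "E_chain E q r ys"
  shows "E_homotopic E (xs @ tl ys) (xs' @ tl ys)"
  using assms(1) unfolding E_homotopic_def
proof (induction rule: rtranclp_induct)
  case (step y z)
  then have "E_homotopic E xs y" "E_homotopic E xs z"
    unfolding E_homotopic_def by auto
  then have "E_chain E p q y" "E_chain E p q z"
    using E_homotopic_chain assms(2) by metis+
  then have "symclp (E_step E) (y @ tl ys) (z @ tl ys)"
    using step(2) E_step_append_right[OF _ _ assms(3)] unfolding symclp_def by blast
  then show ?case
    using step(3) by auto
qed simp

lemma E_homotopic_append_left:
  assumes "E_homotopic E ys ys'" "E_chain E p q xs" "E_chain E q r ys"
  shows "E_homotopic E (xs @ tl ys) (xs @ tl ys')"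
  using assms(1) unfolding E_homotopic_def
proof (induction rule: rtranclp_induct)
  case (step y z)
  then have "E_homotopic E ys y" "E_homotopic E ys z"
    unfolding E_homotopic_def by auto
  then have "E_chain E q r y" "E_chain E q r z"
    using E_homotopic_chain assms(3) by metis+
  then have "symclp (E_step E) (xs @ tl y) (xs @ tl z)"
    using step(2) E_step_append_left[OF _ assms(2)] unfolding symclp_def by blast
  then show ?case
    using step(3) by auto
qed simp

lemma E_homotopic_append:
  assumes "E_homotopic E xs xs'" "E_homotopic E ys ys'" "E_chain E p q xs" "E_chain E q r ys"
  shows "E_homotopic E (xs @ tl ys) (xs' @ tl ys')"
  using E_homotopic_append_right[OF assms(1,3,4)]
    E_homotopic_append_left[OF assms(2) E_homotopic_chain[OF assms(1,3)] assms(4)]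
  by (rule E_homotopic_trans)


subsection \<open>The loop group\<close>

lemma loop_group_mult:
  assumes "E_chain E b b xs" "E_chain E b b ys"
  shows "E_class E xs \<otimes>\<^bsub>loop_group E b\<^esub> E_class E ys = E_class E (xs @ tl ys)"
proof -
  have "E_class E (xs' @ tl ys') = E_class E (xs @ tl ys)"
    if "xs' \<in> E_class E xs" "ys' \<in> E_class E ys" for xs' ys'
  proof -
    have "E_homotopic E xs xs'" "E_homotopic E ys ys'"
      using that by (simp_all add: E_class_def)
    then show ?thesis
      unfolding E_class_eq_iff using assms by (intro E_homotopic_sym[OF E_homotopic_append])
  qed
  moreover have "xs \<in> E_class E xs" "ys \<in> E_class E ys"
    by (auto simp: E_class_def)
  ultimately have "(\<Union>xs'\<in>E_class E xs. \<Union>ys'\<in>E_class E ys. E_class E (xs' @ tl ys')) =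
      E_class E (xs @ tl ys)"
    by blast
  then show ?thesis
    by (simp add: loop_group_def)
qed

lemma E_chain_rev: "sym E \<Longrightarrow> E_chain E p q xs \<Longrightarrow> E_chain E q p (rev xs)"
  by (auto simp: E_chain_def hd_rev last_rev sym_def elim!: successively_mono)

lemma E_homotopic_rev:
  assumes "refl E" "sym E" "E_chain E p q xs"
  shows "E_homotopic E (xs @ tl (rev xs)) [p]"
  using assms(3)
proof (induction xs arbitrary: p)
  case (Cons x xs)
  have xp: "x = p"
    using Cons.prems by (simp add: E_chain_def)
  show ?case
  proof (cases "xs = []")
    case False
    define y where "y = hd xs"
    have xy: "(p, y) \<in> E" "(y, p) \<in> E" and pp: "(p, p) \<in> E"
      using Cons.prems False xp assms(1,2)
      by (auto simp: E_chain_def y_def successively_Cons refl_on_def dest: symD)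
    have cxs: "E_chain E y q xs"
      using Cons.prems False by (auto simp: E_chain_def y_def successively_Cons)
    have c1: "E_chain E p y [p, y]" and c2: "E_chain E y p [y, p]"
      using xy by (auto simp: E_chain_def)
    have c: "E_chain E y y (xs @ tl (rev xs))"
      using E_chain_append[OF cxs E_chain_rev[OF assms(2) cxs]] .
    have "E_homotopic E ([p, y] @ tl (xs @ tl (rev xs))) ([p, y] @ tl [y])"
      by (rule E_homotopic_append_left[OF Cons.IH[OF cxs] c1 c])
    then have "E_homotopic E (([p, y] @ tl (xs @ tl (rev xs))) @ tl [y, p])
        (([p, y] @ tl [y]) @ tl [y, p])"
      by (rule E_homotopic_append_right[OF _ E_chain_append[OF c1 c] c2])
    moreover have "([p, y] @ tl (xs @ tl (rev xs))) @ tl [y, p] = (x # xs) @ tl (rev (x # xs))"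
    proof -
      have "y # tl (xs @ zs) = xs @ zs" for zs
        using False by (cases xs) (auto simp: y_def)
      then show ?thesis
        using False xp by simp
    qed
    moreover have "E_homotopic E [p, y, p] [p, p]"
    proof (rule E_homotopic_sym, rule E_homotopic_step)
      have "[p, p] = [p] @ [p]" "[p, y, p] = [p] @ y # [p]"
        by simp_all
      moreover have "E_chain E p p [p, p]" "E_chain E p p [p, y, p]"
        using xy pp by (auto simp: E_chain_def)
      ultimately show "E_step E [p, p] [p, y, p]"
        unfolding E_step_def by blast
    qed
    moreover have "E_homotopic E [p, p] [p]"
    proof (rule E_homotopic_sym, rule E_homotopic_step)
      have "[p] = [p] @ []" "[p, p] = [p] @ p # []"
        by simp_all
      moreover have "E_chain E p p [p, p]" "E_chain E p p [p]"
        using pp by (auto simp: E_chain_def)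
      ultimately show "E_step E [p] [p, p]"
        unfolding E_step_def by blast
    qed
    ultimately show ?thesis
      by (metis E_homotopic_trans append_Cons append_Nil list.sel(3))
  qed (simp add: xp)
qed (simp add: E_chain_def)

lemma entourage_refl: "entourage E \<Longrightarrow> refl E"
  unfolding entourage_def refl_on_def using uniformity_refl by auto

lemma group_loop_group:
  assumes "entourage E"
  shows "group (loop_group E b)"
proof -
  have car: "carrier (loop_group E b) = {E_class E xs |xs. E_chain E b b xs}"
    and one: "\<one>\<^bsub>loop_group E b\<^esub> = E_class E [b]"
    by (simp_all add: loop_group_def)
  have triv: "E_chain E b b [b]"
    by (simp add: E_chain_def)
  have app: "E_chain E b b (xs @ tl ys)" if "E_chain E b b xs" "E_chain E b b ys" for xs ys
    using E_chain_append that .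
  show ?thesis
  proof (rule groupI)
    fix x y z
    assume "x \<in> carrier (loop_group E b)" "y \<in> carrier (loop_group E b)"
      "z \<in> carrier (loop_group E b)"
    then obtain xs ys zs where *: "x = E_class E xs" "y = E_class E ys" "z = E_class E zs"
      "E_chain E b b xs" "E_chain E b b ys" "E_chain E b b zs"
      by (auto simp: car)
    have "ys \<noteq> []"
      using * by (simp add: E_chain_def)
    then show "x \<otimes>\<^bsub>loop_group E b\<^esub> y \<otimes>\<^bsub>loop_group E b\<^esub> z =
        x \<otimes>\<^bsub>loop_group E b\<^esub> (y \<otimes>\<^bsub>loop_group E b\<^esub> z)"
      using * by (simp add: loop_group_mult app)
  next
    fix x assume "x \<in> carrier (loop_group E b)"
    then obtain xs where xs: "x = E_class E xs" "E_chain E b b xs"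
      by (auto simp: car)
    have "[b] @ tl xs = xs"
      using xs by (cases xs) (auto simp: E_chain_def)
    then show "\<one>\<^bsub>loop_group E b\<^esub> \<otimes>\<^bsub>loop_group E b\<^esub> x = x"
      using loop_group_mult[OF triv xs(2)] by (simp add: one xs)
    have sym: "sym E"
      using assms by (simp add: entourage_def)
    have r: "E_chain E b b (rev xs)"
      using E_chain_rev[OF sym xs(2)] .
    have "E_homotopic E (rev xs @ tl xs) [b]"
      using E_homotopic_rev[OF entourage_refl[OF assms] sym r] by simp
    then have "E_class E (rev xs) \<otimes>\<^bsub>loop_group E b\<^esub> x = \<one>\<^bsub>loop_group E b\<^esub>"
      using loop_group_mult[OF r xs(2)] by (simp add: one xs E_class_eq_iff)
    then show "\<exists>y\<in>carrier (loop_group E b). y \<otimes>\<^bsub>loop_group E b\<^esub> x = \<one>\<^bsub>loop_group E b\<^esub>"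
      using r car by blast
  next
    fix x y assume "x \<in> carrier (loop_group E b)" "y \<in> carrier (loop_group E b)"
    then obtain xs ys where "x = E_class E xs" "y = E_class E ys"
      "E_chain E b b xs" "E_chain E b b ys"
      by (auto simp: car)
    then show "x \<otimes>\<^bsub>loop_group E b\<^esub> y \<in> carrier (loop_group E b)"
      using app[of xs ys] by (auto simp: loop_group_mult car)
  next
    show "\<one>\<^bsub>loop_group E b\<^esub> \<in> carrier (loop_group E b)"
      using triv car one by blast
  qed
qed


subsection \<open>The uniformity of the chain space\<close>

lemma entourage_Int: "entourage D \<Longrightarrow> entourage D' \<Longrightarrow> entourage (D \<inter> D')"
  unfolding entourage_def by (auto simp: sym_Int eventually_conj_iff)

lemma eventually_chain_space_uniformity:
  assumes "entourage E"
  shows "eventually P (chain_space_uniformity E b) \<longleftrightarrow>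
    (\<exists>D. entourage D \<and> D \<subseteq> E \<and> (\<forall>p\<in>star_entourage E b D. P p))"
proof -
  have "eventually P (chain_space_uniformity E b) \<longleftrightarrow>
      (\<exists>D\<in>{D. entourage D \<and> D \<subseteq> E}. eventually P (principal (star_entourage E b D)))"
    unfolding chain_space_uniformity_def
  proof (rule eventually_INF_base)
    show "{D. entourage D \<and> D \<subseteq> E} \<noteq> {}"
      using assms by blast
    fix D D' assume *: "D \<in> {D. entourage D \<and> D \<subseteq> E}" "D' \<in> {D. entourage D \<and> D \<subseteq> E}"
    have "star_entourage E b (D \<inter> D') \<subseteq> star_entourage E b D \<inter> star_entourage E b D'"
      unfolding star_entourage_def by blast
    then show "\<exists>x\<in>{D. entourage D \<and> D \<subseteq> E}. principal (star_entourage E b x)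
        \<le> inf (principal (star_entourage E b D)) (principal (star_entourage E b D'))"
      using * entourage_Int[of D D'] by (intro bexI[of _ "D \<inter> D'"]) auto
  qed
  then show ?thesis
    by (auto simp: eventually_principal)
qed

lemma eventually_chain_space_carrier:
  assumes "entourage E"
  shows "eventually (\<lambda>(x, y). x \<in> chain_space E b \<and> y \<in> chain_space E b)
    (chain_space_uniformity E b)"
  unfolding eventually_chain_space_uniformity[OF assms]
  by (rule exI[of _ E]) (use assms in \<open>auto simp: star_entourage_def chain_space_def\<close>)

lemma sym_star_entourage: "sym D \<Longrightarrow> sym (star_entourage E b D)"
  unfolding star_entourage_def sym_def by blast

lemma E_homotopic_duplicate_last:
  assumes "refl E" "E_chain E p q xs"
  shows "E_homotopic E xs (xs @ [q])"
proof (rule E_homotopic_step)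
  have "xs = xs @ []" "xs @ [q] = xs @ q # []"
    by simp_all
  moreover have "E_chain E p q (xs @ [q])"
    using assms by (auto simp: E_chain_def successively_append_iff refl_on_def)
  ultimately show "E_step E xs (xs @ [q])"
    unfolding E_step_def using assms(2) by blast
qed

lemma refl_star_entourage:
  assumes "refl E" "refl D" "x \<in> chain_space E b"
  shows "(x, x) \<in> star_entourage E b D"
proof -
  obtain xs q where xs: "x = E_class E xs" "E_chain E b q xs"
    using assms(3) by (auto simp: chain_space_def)
  have "x = E_class E (xs @ [q])"
    using E_homotopic_duplicate_last[OF assms(1) xs(2)] xs by (simp add: E_class_eq_iff)
  moreover have "E_chain E b q (xs @ [q])"
    using assms xs by (auto simp: E_chain_def successively_append_iff refl_on_def)
  ultimately show ?thesis
    using assms(2) xs unfolding star_entourage_def refl_on_def E_chain_def by blast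
qed

lemma star_entourage_relcomp:
  assumes "sym D" "D O D \<subseteq> D'" "D \<subseteq> E" "D' \<subseteq> E"
  shows "star_entourage E b D O star_entourage E b D \<subseteq> star_entourage E b D'"
proof clarify
  fix A B C
  assume "(A, B) \<in> star_entourage E b D" "(B, C) \<in> star_entourage E b D"
  then obtain xs y z xs' z' w where
    1: "A = E_class E (xs @ [y])" "B = E_class E (xs @ [z])" "xs \<noteq> []"
      "E_chain E b y (xs @ [y])" "E_chain E b z (xs @ [z])" "(y, z) \<in> D" and
    2: "B = E_class E (xs' @ [z'])" "C = E_class E (xs' @ [w])" "xs' \<noteq> []"
      "E_chain E b z' (xs' @ [z'])" "E_chain E b w (xs' @ [w])" "(z', w) \<in> D"
    unfolding star_entourage_def by blast
  have h: "E_homotopic E (xs @ [z]) (xs' @ [z'])"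
    using 1(2) 2(1) E_class_eq_iff by metis
  then have "E_chain E b z (xs' @ [z'])"
    using E_homotopic_chain 1 by metis
  then have z': "z' = z"
    by (simp add: E_chain_def)
  have ins: "E_class E (vs @ [u]) = E_class E ((vs @ [z]) @ [u]) \<and> E_chain E b u ((vs @ [z]) @ [u])"
    if "vs \<noteq> []" "E_chain E b u (vs @ [u])" "E_chain E b z (vs @ [z])" "(z, u) \<in> E" for vs u
  proof -
    have "E_chain E b u ((vs @ [z]) @ [u])"
      using that by (auto simp: E_chain_def successively_append_iff)
    moreover have "(vs @ [z]) @ [u] = vs @ z # [u]"
      by simp
    ultimately have "E_step E (vs @ [u]) ((vs @ [z]) @ [u])"
      unfolding E_step_def using that(2) by blast
    then show ?thesis
      using E_homotopic_step \<open>E_chain E b u ((vs @ [z]) @ [u])\<close> by (auto simp: E_class_eq_iff)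
  qed
  have zy: "(z, y) \<in> E" and zw: "(z, w) \<in> E" and yw: "(y, w) \<in> D'"
    using 1 2 z' assms by (auto dest: symD)
  have c: "E_chain E z y [z, y]"
    using zy by (simp add: E_chain_def)
  have "E_homotopic E ((xs @ [z]) @ [y]) ((xs' @ [z]) @ [y])"
    using E_homotopic_append_right[OF h 1(5) c] z' by simp
  then have "A = E_class E ((xs' @ [z]) @ [y])" "E_chain E b y ((xs' @ [z]) @ [y])"
    using ins[OF 1(3,4,5) zy] 1(1) E_homotopic_chain E_class_eq_iff by metis+
  moreover have "C = E_class E ((xs' @ [z]) @ [w])" "E_chain E b w ((xs' @ [z]) @ [w])"
    using ins[OF 2(3,5) _ zw] 2(2,4) z' by simp_all
  ultimately show "(A, C) \<in> star_entourage E b D'"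
    using yw unfolding star_entourage_def by blast
qed

end

theory Submission
  imports Defs
begin

text \<open>
  Choose an entourage \<open>F\<close> with \<open>F O F O F \<subseteq> E\<close>. Two facts make \<open>\<delta>\<^sub>E(X)\<close> finitely generated.

  First, every \<open>E\<close>-loop is \<open>E\<close>-homotopic to an \<open>F\<close>-loop. Chain connectedness of \<open>X\<^sub>E\<close> joins the
  class of the trivial loop to the class of any \<open>E\<close>-chain by a chain of classes in which
  neighbours are \<open>F\<^sup>*\<close>-close. One \<open>F\<^sup>*\<close>-step amounts to appending a single point
  that is \<open>F\<close>-close to the current end (\<open>star_entourage_extend\<close>), so the endpoints of these classes
  form an \<open>F\<close>-chain representing the last class (\<open>E_homotopic_fine_chain\<close>).

  Second, \<open>F\<close>-loops can be pushed into a finite graph. By compactness there is a finite set \<open>V\<close>,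
  containing \<open>b\<close>, with every point of \<open>X\<close> being \<open>F\<close>-close to some \<open>v \<in> V\<close>. If \<open>x, y\<close> are \<open>F\<close>-close
  and \<open>v, w \<in> V\<close> are \<open>F\<close>-close to \<open>x\<close> and \<open>y\<close>, then any two of the four points are \<open>E\<close>-close, so an
  \<open>F\<close>-loop is \<open>E\<close>-homotopic to an \<open>E\<close>-loop with vertices in \<open>V\<close>. Fix for each reachable \<open>v \<in> V\<close> an
  \<open>E\<close>-chain \<open>\<gamma> v\<close> from \<open>b\<close> to \<open>v\<close>. As in the computation of the fundamental group of a finite graph,
  inserting a detour along \<open>\<gamma> v\<close> to \<open>b\<close> and back at each vertex factors such a loop into the classes
  of the finitely many loops that run along \<open>\<gamma> v\<close>, over one edge from \<open>v\<close> to \<open>w\<close>, and back along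
  \<open>\<gamma> w\<close>. The lemma \<open>fine_chain_mem_generate\<close> moves a chain to \<open>V\<close> and factors it in a single
  induction.
\<close>

section \<open>Homotopies inside longer chains\<close>

lemma E_chain_append_iff:
  assumes "xs \<noteq> []" "ys \<noteq> []"
  shows "E_chain E p q (xs @ ys) \<longleftrightarrow>
    E_chain E p (last xs) xs \<and> (last xs, hd ys) \<in> E \<and> E_chain E (hd ys) q ys"
  using assms by (auto simp: E_chain_def successively_append_iff)

lemma E_chain_singleton [simp]: "E_chain E p q [x] \<longleftrightarrow> p = x \<and> q = x"
  by (auto simp: E_chain_def)

lemma E_chain_join:
  assumes "E_chain E p q xs" "(q, r) \<in> E" "E_chain E r s ys"
  shows "E_chain E p s (xs @ ys)"
  using assms by (auto simp: E_chain_def successively_append_iff)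

lemma E_chain_mono: "E_chain F p q xs \<Longrightarrow> F \<subseteq> E \<Longrightarrow> E_chain E p q xs"
  unfolding E_chain_def by (blast intro: successively_mono)

lemma E_chain_replace_middle:
  assumes "E_chain E p q (us @ xs @ vs)" "E_chain E r s xs" "E_chain E r s ys"
  shows "E_chain E p q (us @ ys @ vs)"
  using assms
  by (cases "us = []"; cases "vs = []") (auto simp: E_chain_def successively_append_iff)

lemma E_step_context:
  assumes "E_step E xs ys" "E_chain E p q (us @ xs @ vs)"
  shows "E_step E (us @ xs @ vs) (us @ ys @ vs)"
proof -
  obtain r s where "E_chain E r s xs" "E_chain E r s ys"
    using assms(1) unfolding E_step_def by blast
  then have "E_chain E p q (us @ ys @ vs)"
    using E_chain_replace_middle assms(2) by metis
  moreover obtain as z bs where "xs = as @ bs" "ys = as @ z # bs"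
    using assms(1) unfolding E_step_def by blast
  then have "us @ xs @ vs = (us @ as) @ (bs @ vs)" "us @ ys @ vs = (us @ as) @ z # (bs @ vs)"
    by simp_all
  ultimately show ?thesis
    unfolding E_step_def using assms(2) by blast
qed

lemma E_homotopic_context:
  assumes "E_homotopic E xs ys" "E_chain E p q (us @ xs @ vs)"
  shows "E_homotopic E (us @ xs @ vs) (us @ ys @ vs)"
  using assms(1) unfolding E_homotopic_def
proof (induction rule: rtranclp_induct)
  case (step y z)
  have y: "E_chain E p q (us @ y @ vs)"
    using E_homotopic_chain[of E "us @ xs @ vs"] step(3) assms(2)
    unfolding E_homotopic_def by blast
  obtain r s where "E_chain E r s y" "E_chain E r s z"
    using step(2) unfolding symclp_def E_step_def by blast
  then have z: "E_chain E p q (us @ z @ vs)"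
    using E_chain_replace_middle y by metis
  have "symclp (E_step E) (us @ y @ vs) (us @ z @ vs)"
    using step(2) E_step_context[OF _ y] E_step_context[OF _ z] unfolding symclp_def by blast
  then show ?case
    using step(3) by auto
qed simp

lemma E_homotopic_insert:
  assumes "E_chain E p q (us @ vs)" "E_chain E p q (us @ z # vs)"
  shows "E_homotopic E (us @ vs) (us @ z # vs)"
  by (rule E_homotopic_step) (use assms in \<open>unfold E_step_def, blast\<close>)

section \<open>Refining chains\<close>

text \<open>
  An \<open>F\<^sup>*\<close>-step comes with some common initial part \<open>us\<close> unrelated to the given representative
  \<open>xs\<close>. Since \<open>y\<close> and \<open>z\<close> are \<open>E\<close>-close, \<open>us @ [z]\<close> is homotopic to \<open>us @ [y, z]\<close>, and there
  \<open>us @ [y]\<close> can be exchanged for \<open>xs\<close>.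
\<close>

lemma star_entourage_extend:
  assumes F: "F \<subseteq> E" "E_chain F b y xs"
    and star: "(E_class E xs, B) \<in> star_entourage E b F"
  obtains z where "E_chain F b z (xs @ [z])" "B = E_class E (xs @ [z])"
proof -
  obtain us y' z where *: "E_class E xs = E_class E (us @ [y'])" "B = E_class E (us @ [z])"
      "us \<noteq> []" "E_chain E b y' (us @ [y'])" "E_chain E b z (us @ [z])" "(y', z) \<in> F"
    using star unfolding star_entourage_def by blast
  have xs: "E_chain E b y xs"
    using E_chain_mono[OF F(2,1)] .
  have h: "E_homotopic E (us @ [y']) xs"
    using *(1) E_class_eq_iff by metis
  then have "E_chain E b y (us @ [y'])"
    using xs E_homotopic_chain E_homotopic_sym by metis
  \<comment> \<open>Homotopies fix endpoints.\<close>
  then have y': "y' = y"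
    by (simp add: E_chain_def)
  have yz: "(y, z) \<in> E"
    using * F y' by blast
  have c: "E_chain E b z (us @ y # [z])"
    using * y' yz by (auto simp: E_chain_def successively_append_iff)
  have "E_homotopic E (us @ [z]) (us @ y # [z])"
    using E_homotopic_insert[OF *(5) c] .
  also have "E_homotopic E (us @ y # [z]) (xs @ [z])"
    using E_homotopic_context[OF h, of b z "[]" "[z]"] c y' by simp
  finally have "B = E_class E (xs @ [z])"
    using * by (simp add: E_class_eq_iff)
  moreover have "E_chain F b z (xs @ [z])"
    using F * y' by (auto simp: E_chain_def successively_append_iff)
  ultimately show ?thesis
    using that by blast
qed

text \<open>
  This is the only use of chain connectedness: a chain in \<open>X\<^sub>E\<close> starting at the class of the trivial
  loop is lifted, one step at a time, to a chain in \<open>X\<close>.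
\<close>

lemma E_homotopic_fine_chain:
  assumes E: "entourage E" and F: "entourage F" "F \<subseteq> E"
    and conn: "chain_connected_on (chain_space E b) (chain_space_uniformity E b)"
    and xs: "E_chain E b q xs"
  obtains ys where "E_chain F b q ys" "E_homotopic E xs ys"
proof -
  have symF: "sym F"
    using F by (simp add: entourage_def)
  have lift: "\<exists>ys y. E_chain F b y ys \<and> A = E_class E ys"
    if "E_chain (star_entourage E b F) (E_class E [b]) A As" for A As
    using that
  proof (induction As arbitrary: A rule: rev_induct)
    case (snoc B As)
    have BA: "B = A"
      using snoc.prems by (simp add: E_chain_def)
    show ?case
    proof (cases "As = []")
      case True
      then have "A = E_class E [b]"
        using snoc.prems BA by (simp add: E_chain_def)
      moreover have "E_chain F b b [b]"
        by (simp add: E_chain_def)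
      ultimately show ?thesis
        by blast
    next
      case False
      then have As: "E_chain (star_entourage E b F) (E_class E [b]) (last As) As"
        "(last As, A) \<in> star_entourage E b F"
        using snoc.prems BA by (simp_all add: E_chain_append_iff)
      obtain ys y where "E_chain F b y ys" "(E_class E ys, A) \<in> star_entourage E b F"
        using snoc.IH[OF As(1)] As(2) by metis
      then show ?thesis
        using star_entourage_extend[OF F(2)] by metis
    qed
  qed (simp add: E_chain_def)
  have "eventually (\<lambda>p. p \<in> star_entourage E b F) (chain_space_uniformity E b)"
    using F unfolding eventually_chain_space_uniformity[OF E] by blast
  moreover have "E_class E [b] \<in> chain_space E b" "E_class E xs \<in> chain_space E b"
    using xs unfolding chain_space_def by (auto simp: E_chain_def)
  ultimately obtain As where "E_chain (star_entourage E b F) (E_class E [b]) (E_class E xs) As"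
    using conn sym_star_entourage[OF symF]
    unfolding chain_connected_on_iff[OF eventually_chain_space_carrier[OF E]] by metis
  then obtain ys y where ys: "E_chain F b y ys" "E_class E xs = E_class E ys"
    using lift by blast
  then have h: "E_homotopic E xs ys"
    by (simp add: E_class_eq_iff)
  have "y = q"
    using E_homotopic_chain[OF h xs] ys by (simp add: E_chain_def)
  then show ?thesis
    using that ys h by blast
qed

section \<open>Finite nets and fine entourages\<close>

lemma entourage_cube_root:
  assumes "entourage E"
  obtains F where "entourage F" "F \<subseteq> E" "F O F O F \<subseteq> E"
proof -
  have half: "\<exists>F. entourage F \<and> F O F \<subseteq> D" if D: "entourage D" for D :: "('a \<times> 'a) set"
  proof -
    obtain P where P: "eventually P uniformity" "\<And>x y z. P (x, y) \<Longrightarrow> P (y, z) \<Longrightarrow> (x, z) \<in> D"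
      using uniformity_transE[of "\<lambda>p. p \<in> D"] D unfolding entourage_def by metis
    define F where "F = {(x, y). P (x, y) \<and> P (y, x)}"
    have "eventually (\<lambda>p. p \<in> F) uniformity"
      using eventually_conj[OF P(1) uniformity_sym[OF P(1)]]
      by (rule eventually_mono) (auto simp: F_def)
    then have "entourage F"
      by (auto simp: entourage_def F_def sym_def)
    then show ?thesis
      using P(2) by (auto simp: F_def)
  qed
  obtain D where D: "entourage D" "D O D \<subseteq> E"
    using half[OF assms] by blast
  obtain F where F: "entourage F" "F O F \<subseteq> D"
    using half[OF D(1)] by blast
  have "F \<subseteq> F O F"
    using entourage_refl[OF F(1)] by (auto simp: refl_on_def)
  then have FFF: "F O F O F \<subseteq> E"
    using D(2) F(2) by blast
  have "(x, y) \<in> F O F O F" if "(x, y) \<in> F" for x y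
    using that entourage_refl[OF F(1)] by (auto simp: refl_on_def)
  then have "F \<subseteq> F O F O F"
    by auto
  then have "F \<subseteq> E"
    using FFF by (rule order_trans)
  then show ?thesis
    using that F(1) FFF by metis
qed

lemma compact_finite_net:
  fixes F :: "('a::uniform_space \<times> 'a) set"
  assumes "compact (UNIV :: 'a set)" "entourage F"
  obtains V where "finite V" "\<And>x. \<exists>v\<in>V. (x, v) \<in> F"
proof -
  have nhd: "\<exists>U. open U \<and> v \<in> U \<and> (\<forall>x\<in>U. (x, v) \<in> F)" for v
  proof -
    have "eventually (\<lambda>(v', x). v' = v \<longrightarrow> (x, v) \<in> F) uniformity"
      using assms(2) unfolding entourage_def
      by (auto elim!: eventually_mono dest: symD)
    then show ?thesis
      unfolding eventually_nhds_uniformity[symmetric] eventually_nhds .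
  qed
  then obtain U where U: "\<And>v. open (U v)" "\<And>v. v \<in> U v" "\<And>v x. x \<in> U v \<Longrightarrow> (x, v) \<in> F"
    by metis
  obtain V where V: "finite V" "UNIV \<subseteq> (\<Union>v\<in>V. U v)"
    by (rule compactE_image[OF assms(1), of UNIV U]) (use U(1,2) in auto)
  have "\<exists>v\<in>V. (x, v) \<in> F" for x
  proof -
    obtain v where "v \<in> V" "x \<in> U v"
      using V(2) by auto
    then show ?thesis
      using U(3) by metis
  qed
  then show ?thesis
    using that V(1) by metis
qed

section \<open>Finite generation\<close>

text \<open>
  Induction along the \<open>F\<close>-chain, closing it up at each stage by stepping from its end \<open>x\<close> to a
  nearby \<open>v \<in> V\<close> and returning to \<open>b\<close> along \<open>\<gamma> v\<close>. Suppose that the chain grows from \<open>y\<close> to \<open>x\<close>,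
  and that \<open>u, v \<in> V\<close> are close to \<open>y\<close> and \<open>x\<close>. The four points are pairwise \<open>E\<close>-close, so the path
  through \<open>y, x, v\<close> may be replaced by the one through \<open>y, u, v\<close>. A detour from \<open>u\<close> to \<open>b\<close> and back
  along \<open>\<gamma> u\<close> then splits the new loop into the previous loop and a generator. The convention
  \<open>\<gamma> b = [b]\<close> makes the initial loop itself a generator.
\<close>

lemma fine_chain_mem_generate:
  assumes E: "entourage E" and F: "entourage F" "F O F O F \<subseteq> E"
    and net: "\<And>x. \<exists>v\<in>V. (x, v) \<in> F" and bV: "b \<in> V"
    and \<gamma>: "\<gamma> b = [b]" "\<And>v xs. E_chain E b v xs \<Longrightarrow> E_chain E b v (\<gamma> v)"
    and xs: "E_chain F b x xs" and v: "v \<in> V" "(x, v) \<in> F"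
  shows "E_class E (xs @ rev (\<gamma> v)) \<in> generate (loop_group E b)
    {E_class E (\<gamma> v @ rev (\<gamma> w)) |v w. v \<in> V \<and> w \<in> V \<and> E_chain E b b (\<gamma> v @ rev (\<gamma> w))}"
    (is "_ \<in> generate _ ?S")
  using xs v
proof (induction xs arbitrary: x v rule: rev_induct)
  case (snoc x' xs)
  have symE: "sym E" and rE: "refl E" and rF: "refl F" and symF: "sym F"
    using E F entourage_refl by (auto simp: entourage_def)
  have F3: "(p, s) \<in> E" if "(p, q) \<in> F" "(q, r) \<in> F" "(r, s) \<in> F" for p q r s
    using that F by blast
  have F2: "(p, r) \<in> E" if "(p, q) \<in> F" "(q, r) \<in> F" for p q r
    using F3[OF that] rF by (auto simp: refl_on_def)
  have F1: "F \<subseteq> E"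
    using F2 rF by (auto simp: refl_on_def)
  have x': "x' = x"
    using snoc.prems by (simp add: E_chain_def)
  have "E_chain E b x (xs @ [x])" "(x, v) \<in> E"
    using E_chain_mono[OF snoc.prems(1) F1] snoc.prems(3) F1 x' by auto
  then have \<gamma>E: "E_chain E b v (\<gamma> v)"
    using \<gamma>(2)[OF E_chain_join[of E b x "xs @ [x]" v v "[v]"]] by simp
  then have \<gamma>r: "E_chain E v b (rev (\<gamma> v))"
    using E_chain_rev symE by metis
  show ?case
  proof (cases "xs = []")
    case True
    then have xb: "x = b"
      using snoc.prems x' by (simp add: E_chain_def)
    then have "E_chain E b b (\<gamma> b @ rev (\<gamma> v))"
      using E_chain_join[OF _ _ \<gamma>r, of b b "[b]"] snoc.prems F1 \<gamma>(1) by auto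
    then show ?thesis
      using True x' xb snoc.prems bV \<gamma>(1) by (intro generate.incl) force
  next
    case False
    define y where "y = last xs"
    have xsF: "E_chain F b y xs" and yx: "(y, x) \<in> F"
      using snoc.prems False x' by (auto simp: y_def E_chain_append_iff)
    have xsE: "E_chain E b y xs"
      using E_chain_mono[OF xsF F1] .
    obtain u where u: "u \<in> V" "(y, u) \<in> F"
      using net by blast
    have E: "(y, x) \<in> E" "(x, v) \<in> E" "(y, v) \<in> E" "(y, u) \<in> E" "(u, v) \<in> E"
      using F1 yx u snoc.prems(3) F2 F3 symF by (auto dest: symD)
    have \<gamma>u: "E_chain E b u (\<gamma> u)"
      using \<gamma>(2)[OF E_chain_join[OF xsE E(4), of u "[u]"]] by simp
    then have \<gamma>ur: "E_chain E u b (rev (\<gamma> u))"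
      using E_chain_rev symE by metis
    have c1: "E_chain E b b (xs @ rev (\<gamma> u))"
      using E_chain_join[OF xsE E(4) \<gamma>ur] .
    have c2: "E_chain E b b (\<gamma> u @ rev (\<gamma> v))"
      using E_chain_join[OF \<gamma>u E(5) \<gamma>r] .
    have c3: "E_chain E b b (xs @ rev (\<gamma> v))"
      using E_chain_join[OF xsE E(3) \<gamma>r] .
    have c4: "E_chain E b b (xs @ x # rev (\<gamma> v))"
      using E_chain_join[OF xsE E(1), of b "[x] @ rev (\<gamma> v)"] E_chain_join[OF _ E(2) \<gamma>r, of x "[x]"]
      by simp
    have c5: "E_chain E b b (xs @ u # rev (\<gamma> v))"
      using E_chain_join[OF xsE E(4), of b "[u] @ rev (\<gamma> v)"] E_chain_join[OF _ E(5) \<gamma>r, of u "[u]"]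
      by simp
    have ne: "\<gamma> u \<noteq> []"
      using \<gamma>u by (simp add: E_chain_def)
    \<comment> \<open>Remove \<open>x\<close>, insert \<open>u\<close>, and expand \<open>u\<close> to the detour along \<open>\<gamma> u\<close>.\<close>
    have "E_homotopic E (xs @ x # rev (\<gamma> v)) (xs @ rev (\<gamma> v))"
      using E_homotopic_insert[OF c3 c4] by (rule E_homotopic_sym)
    also have "E_homotopic E (xs @ rev (\<gamma> v)) (xs @ u # rev (\<gamma> v))"
      using E_homotopic_insert[OF c3 c5] .
    also have "E_homotopic E (xs @ u # rev (\<gamma> v)) (xs @ (rev (\<gamma> u) @ tl (\<gamma> u)) @ rev (\<gamma> v))"
    proof -
      have detour: "E_homotopic E [u] (rev (\<gamma> u) @ tl (\<gamma> u))"
        using E_homotopic_rev[OF rE symE \<gamma>ur] E_homotopic_sym by fastforce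
      show ?thesis
        using E_homotopic_context[OF detour, of b b xs "rev (\<gamma> v)"] c5 by simp
    qed
    finally have "E_class E (xs @ x # rev (\<gamma> v)) =
        E_class E (xs @ rev (\<gamma> u)) \<otimes>\<^bsub>loop_group E b\<^esub> E_class E (\<gamma> u @ rev (\<gamma> v))"
      using ne by (simp add: loop_group_mult[OF c1 c2] E_class_eq_iff)
    moreover have "E_class E (xs @ rev (\<gamma> u)) \<in> generate (loop_group E b) ?S"
      using snoc.IH[OF xsF u] .
    moreover have "E_class E (\<gamma> u @ rev (\<gamma> v)) \<in> generate (loop_group E b) ?S"
      using c2 u snoc.prems by (intro generate.incl) blast
    ultimately show ?thesis
      using x' by (simp add: generate.eng)
  qed
qed (simp add: E_chain_def)

theorem theorem35:
  fixes E :: "('a::uniform_space \<times> 'a) set" and b :: 'a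
  assumes "compact (UNIV :: 'a set)"
    and "entourage E"
    and "chain_connected_on (chain_space E b) (chain_space_uniformity E b)"
  shows "finitely_generated_group (loop_group E b)"
proof -
  let ?G = "loop_group E b"
  interpret group ?G
    using group_loop_group assms(2) .
  obtain F where F: "entourage F" "F O F O F \<subseteq> E" and FE: "F \<subseteq> E"
    using entourage_cube_root[OF assms(2)] .
  have rF: "refl F"
    using entourage_refl[OF F(1)] .
  obtain V' where V': "finite V'" "\<And>x. \<exists>v\<in>V'. (x, v) \<in> F"
    using compact_finite_net[OF assms(1) F(1)] by blast
  define V where "V = insert b V'"
  define \<gamma> where "\<gamma> v = (if v = b then [b] else SOME xs. E_chain E b v xs)" for v
  have \<gamma>: "E_chain E b v (\<gamma> v)" if "E_chain E b v xs" for v xs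
    using someI[of "E_chain E b v", OF that] by (auto simp: \<gamma>_def E_chain_def)
  define S where
    "S = {E_class E (\<gamma> v @ rev (\<gamma> w)) |v w. v \<in> V \<and> w \<in> V \<and> E_chain E b b (\<gamma> v @ rev (\<gamma> w))}"
  have "S \<subseteq> (\<lambda>(v, w). E_class E (\<gamma> v @ rev (\<gamma> w))) ` (V \<times> V)"
    unfolding S_def by auto
  then have fin: "finite S"
    by (rule finite_subset) (simp add: V_def V'(1))
  have sub: "S \<subseteq> carrier ?G"
    unfolding S_def loop_group_def by auto
  have net: "\<exists>v\<in>V. (x, v) \<in> F" for x
    using V'(2)[of x] by (auto simp: V_def)
  have b: "b \<in> V" "\<gamma> b = [b]" "(b, b) \<in> F"
    using rF by (auto simp: V_def \<gamma>_def refl_on_def)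
  have "A \<in> generate ?G S" if A: "A \<in> carrier ?G" for A
  proof -
    obtain xs where xs: "A = E_class E xs" "E_chain E b b xs"
      using A by (auto simp: loop_group_def)
    obtain ys where ys: "E_chain F b b ys" "E_homotopic E xs ys"
      using E_homotopic_fine_chain[OF assms(2) F(1) FE assms(3) xs(2)] .
    \<comment> \<open>Closing up at \<open>v = b\<close> merely repeats the last point of the loop, as \<open>\<gamma> b = [b]\<close>.\<close>
    have "E_class E (ys @ rev (\<gamma> b)) \<in> generate ?G S"
      unfolding S_def
      by (rule fine_chain_mem_generate[OF assms(2) F net b(1,2) \<gamma> ys(1) b(1,3)])
    moreover have "E_homotopic E xs (ys @ [b])"
      using ys(2) E_homotopic_duplicate_last[OF entourage_refl[OF assms(2)] E_chain_mono[OF ys(1) FE]]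
      by (rule E_homotopic_trans)
    then have "A = E_class E (ys @ rev (\<gamma> b))"
      by (simp add: xs(1) b(2) E_class_eq_iff)
    ultimately show ?thesis
      by simp
  qed
  then have "generate ?G S = carrier ?G"
    using generate_incl[OF sub] by (intro equalityI subsetI) auto
  then show ?thesis
    unfolding finitely_generated_group_def
    by (intro conjI exI[of _ S] group_axioms fin sub)
qed

end
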